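(* Let $K=\mathbb{R}$ or $K=\mathbb{C}$, $n\in\mathbb{Z}_{>0}$, and let $\varphi^{[n]}:\mathbb{R}^n\to K$ be an $n$-dimensional tensor product mother scaling function, with associated spaces $V^{(0)}_j$, $j\in\mathbb{Z}$. Then the following conditions hold: (MRA2.1) $V^{(0)}_j\subset V^{(0)}_{j+1}$ for all $j\in\mathbb{Z}$; (MRA2.2) $\overline{\bigcup_{j\in\mathbb{Z}}V^{(0)}_j}=C_0(\mathbb{R}^n,K)$ (closure in the supremum norm); (MRA2.3) $\bigcap_{j\in\mathbb{Z}}V^{(0)}_j=\{0\}$; (MRA2.4) for all $j\in\mathbb{Z}$ and all functions $f:\mathbb{R}^n\to K$: $f\in V^{(0)}_j\iff f(2\,\cdot)\in V^{(0)}_{j+1}$; (MRA2.5) for all $j\in\mathbb{Z}$, $k\in\mathbb{Z}^n$ and all functions $f:\mathbb{R}^n\to K$: $f\in V^{(0)}_j\iff f(\cdot-2^{-j}k)\in V^{(0)}_j$; (MRA2.6) $\varphi^{[n]}(k)=\delta_{k,0}$ for all $k\in\mathbb{Z}^n$.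
   Context: $C_0(\mathbb{R}^n,K)$ is the Banach space of continuous functions $\mathbb{R}^n\to K$ vanishing at infinity, with the supremum norm. $c_0(\mathbb{Z}^n,K)$ is the space of families $(a_k)_{k\in\mathbb{Z}^n}$ in $K$ tending to $0$ along some (equivalently any) enumeration of $\mathbb{Z}^n$, with the supremum norm. $\varphi:\mathbb{R}\to K$ is a compactly supported interpolating mother scaling function: it is continuous and compactly supported, $\varphi(k)=\delta_{k,0}$ for all $k\in\mathbb{Z}$, and $\varphi(x)=\sum_{k\in\mathbb{Z}}\varphi(k/2)\varphi(2x-k)$ for all $x\in\mathbb{R}$. The $n$-dimensional tensor product mother scaling function generated by $\varphi$ is $\varphi^{[n]}(x)=\prod_{i=1}^n\varphi(x_i)$, $x\in\mathbb{R}^n$. For $j\in\mathbb{Z}$, $$V^{(0)}_j=\Bigl\{\sum_{k\in\mathbb{Z}^n}a_k\,\varphi^{[n]}(2^j\cdot-k)\ :\ (a_k)_{k}\in c_0(\mathbb{Z}^n,K)\Bigr\}$$ (the series converges unconditionally in the supremum norm), equipped with the supremum norm. *)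

theory Defs
  imports "HOL-Analysis.Analysis"
begin

text \<open>
  The scalar field \<open>K\<close> is a type variable \<open>'k\<close>, to be instantiated with \<^typ>\<open>real\<close> and
  \<^typ>\<open>complex\<close>; the dimension \<open>n\<close> is the cardinality of the index type \<open>'n\<close>.
\<close>

definition int_vec :: "int^'n \<Rightarrow> real^'n" where
  "int_vec k = (\<chi> i. of_int (k $ i))"

definition C0 :: "('a::real_normed_vector \<Rightarrow> 'k::real_normed_vector) set" where
  "C0 = {f. continuous_on UNIV f \<and> (f \<longlongrightarrow> 0) at_infinity}"

text \<open>
  A family on a countably infinite index set tends to \<open>0\<close> along some (equivalently, any)
  enumeration iff it tends to \<open>0\<close> along the cofinite filter.
\<close>

definition c0 :: "('i \<Rightarrow> 'k::real_normed_vector) set" where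
  "c0 = {a. (a \<longlongrightarrow> 0) cofinite}"

definition mother_scaling_function :: "(real \<Rightarrow> 'k::real_normed_field) \<Rightarrow> bool" where
  "mother_scaling_function \<phi> \<longleftrightarrow>
     continuous_on UNIV \<phi> \<and>
     compact (closure {x. \<phi> x \<noteq> 0}) \<and>
     (\<forall>k::int. \<phi> (of_int k) = (if k = 0 then 1 else 0)) \<and>
     (\<forall>x. ((\<lambda>k::int. \<phi> (of_int k / 2) * \<phi> (2 * x - of_int k)) has_sum \<phi> x) UNIV)"

definition tensor :: "(real \<Rightarrow> 'k::real_normed_field) \<Rightarrow> real^'n \<Rightarrow> 'k" where
  "tensor \<phi> x = (\<Prod>i\<in>UNIV. \<phi> (x $ i))"

text \<open>
  The sum of the series is its unconditional limit in the supremum norm, that is, the uniform limit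
  of its finite partial sums. For the functions \<open>\<Phi> = tensor \<phi>\<close> considered here it exists for every
  \<open>a \<in> c0\<close>, see \<open>V0_series_converges\<close> below.
\<close>

definition V0 :: "(real^'n \<Rightarrow> 'k::real_normed_field) \<Rightarrow> int \<Rightarrow> (real^'n \<Rightarrow> 'k) set" where
  "V0 \<Phi> j = {f. \<exists>a\<in>c0. uniform_limit UNIV
       (\<lambda>F x. \<Sum>k\<in>F. a k * \<Phi> ((2 powi j) *\<^sub>R x - int_vec k)) f (finite_subsets_at_top UNIV)}"

text \<open>
  The closure in the second condition is taken in the Banach space of bounded continuous functions
  with the supremum norm. It contains \<^const>\<open>C0\<close> as a closed subspace, so this is the closure
  in \<^const>\<open>C0\<close>. No element of the spaces is lost in passing to that type, see
  \<open>V0_subset_C0\<close> below.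
\<close>

definition MRA2 :: "(real^'n \<Rightarrow> 'k::real_normed_field) \<Rightarrow> (int \<Rightarrow> (real^'n \<Rightarrow> 'k) set) \<Rightarrow> bool" where
  "MRA2 \<Phi> V \<longleftrightarrow>
     (\<forall>j. V j \<subseteq> V (j + 1)) \<and>
     closure {g :: (real^'n) \<Rightarrow>\<^sub>C 'k. apply_bcontfun g \<in> (\<Union>j. V j)} = {g. apply_bcontfun g \<in> C0} \<and>
     (\<Inter>j. V j) = {\<lambda>x. 0} \<and>
     (\<forall>j f. f \<in> V j \<longleftrightarrow> (\<lambda>x. f (2 *\<^sub>R x)) \<in> V (j + 1)) \<and>
     (\<forall>j k f. f \<in> V j \<longleftrightarrow> (\<lambda>x. f (x - (2 powi (- j)) *\<^sub>R int_vec k)) \<in> V j) \<and>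
     (\<forall>k. \<Phi> (int_vec k) = (if k = 0 then 1 else 0))"

lemma C0_subset_bcontfun:
  fixes f :: "'a::euclidean_space \<Rightarrow> 'k::real_normed_vector"
  assumes "f \<in> C0"
  shows "f \<in> bcontfun"
proof -
  have c: "continuous_on UNIV f" and l: "(f \<longlongrightarrow> 0) at_infinity"
    using assms by (auto simp: C0_def)
  obtain b where b: "\<And>x. b \<le> norm x \<Longrightarrow> norm (f x) < 1"
    using tendstoD[OF l, of 1] by (auto simp: eventually_at_infinity)
  have "compact (f ` cball 0 b)"
    by (rule compact_continuous_image) (auto intro: continuous_on_subset[OF c])
  then obtain M where M: "\<And>x. norm x \<le> b \<Longrightarrow> norm (f x) \<le> M"
    using compact_imp_bounded by (force simp: bounded_iff)
  have "norm (f x) \<le> max M 1" for x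
    using b[of x] M[of x] by (cases "norm x \<le> b") auto
  then show ?thesis
    using c by (auto simp: bcontfun_def bounded_iff)
qed

lemma mother_scaling_function_support:
  assumes "mother_scaling_function \<phi>"
  obtains R :: nat where "\<And>x. \<phi> x \<noteq> 0 \<Longrightarrow> \<bar>x\<bar> \<le> real R"
proof -
  have "bounded {x. \<phi> x \<noteq> 0}"
    using assms bounded_subset[OF compact_imp_bounded closure_subset]
    by (auto simp: mother_scaling_function_def)
  then obtain b where b: "\<And>x. \<phi> x \<noteq> 0 \<Longrightarrow> \<bar>x\<bar> \<le> b"
    by (auto simp: bounded_iff)
  show thesis
    by (rule that[of "nat \<lceil>b\<rceil>"]) (use b in \<open>fastforce intro: order_trans real_nat_ceiling_ge\<close>)
qed

lemma tensor_support:
  fixes x :: "real^'n"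
  assumes "\<And>x. \<phi> x \<noteq> 0 \<Longrightarrow> \<bar>x\<bar> \<le> R" and "tensor \<phi> x \<noteq> 0"
  shows "\<bar>x $ i\<bar> \<le> R"
  using assms by (auto simp: tensor_def)

lemma tensor_C0:
  assumes "mother_scaling_function \<phi>"
  shows "(tensor \<phi> :: real^'n \<Rightarrow> 'k::real_normed_field) \<in> C0"
proof -
  have c: "continuous_on UNIV \<phi>"
    using assms by (simp add: mother_scaling_function_def)
  obtain R :: nat where R: "\<And>x. \<phi> x \<noteq> 0 \<Longrightarrow> \<bar>x\<bar> \<le> real R"
    using mother_scaling_function_support[OF assms] by blast
  have "continuous_on UNIV (tensor \<phi> :: real^'n \<Rightarrow> 'k)"
    unfolding tensor_def
    by (intro continuous_on_prod continuous_on_compose2[OF c] continuous_intros) auto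
  moreover have "tensor \<phi> x = 0" if "real R * CARD('n) + 1 \<le> norm x" for x :: "real^'n"
  proof (rule ccontr)
    assume "tensor \<phi> x \<noteq> 0"
    then have "(\<Sum>i\<in>UNIV. \<bar>x $ i\<bar>) \<le> (\<Sum>i\<in>(UNIV::'n set). real R)"
      using tensor_support[of \<phi> "real R", OF R] by (intro sum_mono) auto
    then show False
      using norm_le_l1_cart[of x] that by (simp add: mult.commute)
  qed
  then have "\<forall>\<^sub>F x in at_infinity. (tensor \<phi> :: real^'n \<Rightarrow> 'k) x = 0"
    unfolding eventually_at_infinity by blast
  then have "((tensor \<phi> :: real^'n \<Rightarrow> 'k) \<longlongrightarrow> 0) at_infinity"
    by (rule tendsto_eventually)
  ultimately show ?thesis
    by (simp add: C0_def)
qed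

lemma V0_subset_C0:
  assumes "mother_scaling_function \<phi>"
  shows "V0 (tensor \<phi>) j \<subseteq> (C0 :: (real^'n \<Rightarrow> 'k::real_normed_field) set)"
proof
  fix f :: "real^'n \<Rightarrow> 'k"
  assume "f \<in> V0 (tensor \<phi>) j"
  then obtain a where u: "uniform_limit UNIV
       (\<lambda>F x. \<Sum>k\<in>F. a k * tensor \<phi> ((2 powi j) *\<^sub>R x - int_vec k)) f (finite_subsets_at_top UNIV)"
    by (auto simp: V0_def)
  define s where "s F x = (\<Sum>k\<in>F. a k * tensor \<phi> ((2 powi j) *\<^sub>R x - int_vec k))"
    for F and x :: "real^'n"
  have u': "uniform_limit UNIV s f (finite_subsets_at_top UNIV)"
    using u by (simp add: s_def[abs_def])
  have c: "continuous_on UNIV (tensor \<phi> :: real^'n \<Rightarrow> 'k)"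
    and l: "((tensor \<phi> :: real^'n \<Rightarrow> 'k) \<longlongrightarrow> 0) at_infinity"
    using tensor_C0[OF assms] by (auto simp: C0_def)
  have "continuous_on UNIV (s F)" for F
    unfolding s_def by (intro continuous_intros continuous_on_compose2[OF c]) auto
  then have cf: "continuous_on UNIV f"
    using uniform_limit_theorem[OF _ u'] by simp
  have fl: "filterlim (\<lambda>x::real^'n. (2 powi j) *\<^sub>R x - int_vec k) at_infinity at_infinity" for k
  proof -
    have "r \<le> norm ((2 powi j) *\<^sub>R x - int_vec k)"
      if "(r + norm (int_vec k)) / 2 powi j \<le> norm x" for r and x :: "real^'n"
    proof -
      have "r + norm (int_vec k) \<le> norm ((2 powi j) *\<^sub>R x)"
        using that by (simp add: pos_divide_le_eq mult.commute)
      then show ?thesis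
        using norm_triangle_ineq2[of "(2 powi j) *\<^sub>R x" "int_vec k"] by linarith
    qed
    then show ?thesis
      unfolding filterlim_at_infinity[OF order.refl] eventually_at_infinity by blast
  qed
  have "(s F \<longlongrightarrow> 0) at_infinity" for F
    unfolding s_def
    by (intro tendsto_null_sum tendsto_mult_right_zero filterlim_compose[OF l fl])
  have "(f \<longlongrightarrow> 0) at_infinity"
  proof (rule tendstoI)
    fix e :: real assume e: "e > 0"
    obtain F where F: "\<And>x. dist (s F x) (f x) < e / 2"
      using eventually_happens'[OF _ uniform_limitD[OF u', of "e/2"]] e by auto
    have "\<forall>\<^sub>F x in at_infinity. dist (s F x) 0 < e / 2"
      using \<open>(s F \<longlongrightarrow> 0) at_infinity\<close> e by (intro tendstoD) auto
    then show "\<forall>\<^sub>F x in at_infinity. dist (f x) 0 < e"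
    proof eventually_elim
      case (elim x)
      then show ?case
        using F[of x] dist_triangle[of "f x" 0 "s F x"] by (simp add: dist_commute)
    qed
  qed
  with cf show "f \<in> C0"
    by (simp add: C0_def)
qed

lemma V0_series_converges:
  fixes a :: "int^'n \<Rightarrow> 'k::real_normed_field"
  assumes "mother_scaling_function \<phi>" and "a \<in> c0"
  shows "\<exists>f\<in>V0 (tensor \<phi>) j. uniform_limit UNIV
       (\<lambda>F x. \<Sum>k\<in>F. a k * tensor \<phi> ((2 powi j) *\<^sub>R x - int_vec k)) f (finite_subsets_at_top UNIV)"
proof -
  define h where "h k x = a k * tensor \<phi> ((2 powi j) *\<^sub>R x - int_vec k)" for k and x :: "real^'n"
  obtain R :: nat where R: "\<And>x. \<phi> x \<noteq> 0 \<Longrightarrow> \<bar>x\<bar> \<le> real R"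
    using mother_scaling_function_support[OF assms(1)] by blast
  have "bounded (range (tensor \<phi> :: real^'n \<Rightarrow> 'k))"
    using C0_subset_bcontfun[OF tensor_C0[OF assms(1)]] by (auto simp: bcontfun_def)
  then obtain B where B: "B > 0" "\<And>x::real^'n. norm (tensor \<phi> x) \<le> B"
    by (auto simp: bounded_pos)
  define S where "S x = {k::int^'n. \<forall>i. \<bar>(2 powi j) * x $ i - of_int (k $ i)\<bar> \<le> real R}"
    for x :: "real^'n"
  define N where "N = (2 * R + 1) ^ CARD('n)"
  have S: "finite (S x) \<and> card (S x) \<le> N" for x
  proof -
    define I where "I i = {\<lceil>(2 powi j) * x $ i - R\<rceil>..\<lfloor>(2 powi j) * x $ i + R\<rfloor>}" for i
    have I: "card (I i) \<le> 2 * R + 1" for i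
      unfolding I_def card_atLeastAtMost_int by linarith
    have sub: "S x \<subseteq> vec_lambda ` (PiE UNIV I)"
    proof
      fix k assume "k \<in> S x"
      then have "\<bar>(2 powi j) * x $ i - of_int (k $ i)\<bar> \<le> real R" for i
        by (simp add: S_def)
      then have "k $ i \<in> I i" for i
        unfolding I_def atLeastAtMost_iff ceiling_le_iff le_floor_iff abs_le_iff
        by (smt (verit))
      then have "vec_nth k \<in> PiE UNIV I"
        by auto
      then show "k \<in> vec_lambda ` (PiE UNIV I)"
        by (metis image_eqI vec_nth_inverse)
    qed
    have fin: "finite (PiE UNIV I)"
      by (rule finite_PiE) (auto simp: I_def)
    have "card (S x) \<le> card (PiE UNIV I)"
      using card_mono[OF finite_imageI[OF fin] sub] card_image_le[OF fin, of vec_lambda] by linarith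
    also have "\<dots> = (\<Prod>i\<in>UNIV. card (I i))"
      by (rule card_PiE) simp
    also have "\<dots> \<le> (\<Prod>i\<in>(UNIV::'n set). 2 * R + 1)"
      by (rule prod_mono) (use I in auto)
    finally show ?thesis
      using finite_subset[OF sub finite_imageI[OF fin]] by (simp add: N_def)
  qed
  have h0: "h k x = 0" if "k \<notin> S x" for k x
  proof (rule ccontr)
    assume "h k x \<noteq> 0"
    then have "tensor \<phi> ((2 powi j) *\<^sub>R x - int_vec k) \<noteq> 0"
      by (auto simp: h_def)
    from tensor_support[of \<phi> "real R", OF R this] that show False
      by (auto simp: S_def int_vec_def)
  qed
  define f where "f x = (\<Sum>k\<in>S x. h k x)" for x
  have "uniform_limit UNIV (\<lambda>F x. \<Sum>k\<in>F. h k x) f (finite_subsets_at_top UNIV)"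
  proof (rule uniform_limitI)
    fix e :: real assume e: "e > 0"
    have NB: "N * B > 0" using B by (simp add: N_def)
    define d where "d = e / (2 * (N * B))"
    have d: "d > 0" using e NB by (simp add: d_def)
    define F0 where "F0 = {k. \<not> norm (a k) < d}"
    have F0: "finite F0"
      using tendstoD[of a 0 cofinite d] assms(2) d by (simp add: F0_def c0_def eventually_cofinite)
    have "dist (\<Sum>k\<in>F. h k x) (f x) < e" if F: "finite F" "F0 \<subseteq> F" for F x
    proof -
      have 1: "(\<Sum>k\<in>F. h k x) = (\<Sum>k\<in>S x \<inter> F. h k x)"
        by (rule sum.mono_neutral_right) (use F h0 in auto)
      have 2: "f x = (\<Sum>k\<in>S x \<inter> F. h k x) + (\<Sum>k\<in>S x - F. h k x)"
        unfolding f_def using S[of x] by (simp add: sum.Int_Diff)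
      have "dist (\<Sum>k\<in>F. h k x) (f x) = norm (\<Sum>k\<in>S x - F. h k x)"
        unfolding 1 2 by (simp add: dist_norm)
      also have "\<dots> \<le> (\<Sum>k\<in>S x - F. d * B)"
      proof (rule sum_norm_le)
        fix k assume "k \<in> S x - F"
        then have "norm (a k) < d" using F by (auto simp only: F0_def)
        then have "norm (a k) \<le> d" by simp
        then show "norm (h k x) \<le> d * B"
          unfolding h_def norm_mult using B d by (intro mult_mono) auto
      qed
      also have "\<dots> = card (S x - F) * (d * B)" by simp
      also have "\<dots> \<le> N * (d * B)"
        using S[of x] card_mono[of "S x" "S x - F"] B d
        by (intro mult_right_mono) auto
      also have "\<dots> < e" using NB e by (simp add: d_def field_simps)
      finally show ?thesis .
    qed
    then show "\<forall>\<^sub>F F in finite_subsets_at_top UNIV. \<forall>x\<in>UNIV. dist (\<Sum>k\<in>F. h k x) (f x) < e"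
      unfolding eventually_finite_subsets_at_top using F0 by blast
  qed
  then show ?thesis
    using assms(2) unfolding V0_def h_def by blast
qed

end

theory Submission
  imports Defs
begin

text \<open>
  Write \<open>\<Phi>\<close> for the tensor product. Since \<open>\<Phi>\<close> is \<open>1\<close> at the origin and \<open>0\<close> at the other integer
  vectors, the coefficients of a series \<open>\<Sum>k. a k * \<Phi> (2^j x - k)\<close> are its values at the grid points
  \<open>2^-j k\<close>. Hence the space at level \<open>j\<close> consists of the functions in \<^const>\<open>C0\<close> that are reproduced by
  interpolation on the grid of mesh \<open>2^-j\<close> (\<open>V0_eq_interpolated\<close>). This is the key reformulation: by
  compactness of the support, only finitely many terms are nonzero at a given point, so
  reproduction is a linear condition that survives even pointwise limits
  (\<open>interpolated_limit\<close>). To show that all functions of a level are reproduced at some other level, it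
  therefore suffices to look at the translates of one dilate of \<open>\<Phi>\<close>.

  The refinement equation says that \<open>\<Phi>\<close> is reproduced on the grid of mesh \<open>1/2\<close>. By dilation and
  translation this gives nestedness (\<open>interpolated_nested\<close>), so \<open>\<Phi>\<close> is reproduced on all finer dyadic
  grids. Read at the point \<open>2^-p y\<close>, reproduction on the grid of mesh \<open>2^-p\<close> is
  \<open>\<Phi> (2^-p y) = (\<Sum>k. \<Phi> (2^-p k) * \<Phi> (y - k))\<close>. As \<open>p\<close> grows, both values of \<open>\<Phi>\<close> at shrinking arguments
  tend to \<open>\<Phi> 0 = 1\<close>, and what remains is \<open>1 = (\<Sum>k. \<Phi> (y - k))\<close> (\<open>partition_of_unity\<close>).

  Density follows: interpolating a function \<open>g\<close> in \<^const>\<open>C0\<close> at level \<open>j\<close> makes at \<open>x\<close> the error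
  \<open>\<Sum>k. (g (2^-j k) - g x) * \<Phi> (2^j x - k)\<close>. It involves a bounded number of grid points, all at distance
  \<open>O(2^-j)\<close> from \<open>x\<close>, and \<open>g\<close> is uniformly continuous. For the intersection, let \<open>j\<close> tend to minus
  infinity: a function \<open>f\<close> in \<^const>\<open>C0\<close> becomes small at all grid points other than \<open>0\<close>, so that
  \<open>f x\<close> is approximately \<open>f 0 * \<Phi> (2^j x)\<close>, which tends to \<open>f 0\<close>. Thus \<open>f\<close> is constant, and being
  in \<^const>\<open>C0\<close> it vanishes.
\<close>

section \<open>Grid points and finite overlap\<close>

definition grid_point :: "int \<Rightarrow> int^'n \<Rightarrow> real^'n" where
  "grid_point j k = (2 powi (- j)) *\<^sub>R int_vec k"

lemma int_vec_0 [simp]: "int_vec 0 = 0"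
  by (simp add: int_vec_def vec_eq_iff)

lemma int_vec_add: "int_vec (k + l) = int_vec k + int_vec l"
  by (simp add: int_vec_def vec_eq_iff)

lemma int_vec_diff: "int_vec (k - l) = int_vec k - int_vec l"
  by (simp add: int_vec_def vec_eq_iff)

lemma int_vec_uminus: "int_vec (- k) = - int_vec k"
  by (simp add: int_vec_def vec_eq_iff)

lemma scale_grid_point [simp]: "(2 powi j) *\<^sub>R grid_point j k = int_vec k"
  by (simp add: grid_point_def power_int_minus)

lemma grid_point_0 [simp]: "grid_point j 0 = 0"
  by (simp add: grid_point_def)

lemma finite_int_box:
  assumes "\<And>i. finite (A i)"
  shows "finite {k::int^'n. \<forall>i. k $ i \<in> A i}"
proof (rule finite_subset)
  show "{k::int^'n. \<forall>i. k $ i \<in> A i} \<subseteq> vec_lambda ` PiE UNIV A"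
  proof
    fix k :: "int^'n" assume "k \<in> {k. \<forall>i. k $ i \<in> A i}"
    then show "k \<in> vec_lambda ` PiE UNIV A"
      by (intro image_eqI[of _ _ "vec_nth k"]) auto
  qed
  show "finite (vec_lambda ` PiE UNIV A)"
    using assms by (intro finite_imageI finite_PiE) auto
qed

lemma norm_grid_point_ge:
  assumes "k \<noteq> (0::int^'n)"
  shows "2 powi (- j) \<le> norm (grid_point j k)"
proof -
  obtain i where "k $ i \<noteq> 0"
    using assms by (auto simp: vec_eq_iff)
  then have "1 \<le> \<bar>int_vec k $ i\<bar>"
    by (simp add: int_vec_def)
  then have "1 \<le> norm (int_vec k)"
    using component_le_norm_cart[of "int_vec k" i] by linarith
  then show ?thesis
    by (simp add: grid_point_def)
qed

text \<open>
  A ball contains only finitely many grid points; this is what turns decay at infinity into decay of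
  the sampled values along the cofinite filter.
\<close>

lemma filterlim_grid_point: "filterlim (grid_point j) at_infinity (cofinite :: (int^'n) filter)"
  unfolding filterlim_at_infinity[OF order.refl] eventually_cofinite
proof (intro allI impI)
  fix r :: real
  have "\<bar>k $ i\<bar> \<le> \<lceil>r * 2 powi j\<rceil>" if "\<not> r \<le> norm (grid_point j k)" for k :: "int^'n" and i
  proof -
    have "norm (int_vec k) < r * 2 powi j"
      using that by (simp add: grid_point_def power_int_minus field_simps)
    then have "\<bar>of_int (k $ i)\<bar> < r * 2 powi j"
      using component_le_norm_cart[of "int_vec k" i] by (simp add: int_vec_def)
    then show ?thesis
      by linarith
  qed
  then have "{k::int^'n. \<not> r \<le> norm (grid_point j k)}
      \<subseteq> {k. \<forall>i. k $ i \<in> {- \<lceil>r * 2 powi j\<rceil>..\<lceil>r * 2 powi j\<rceil>}}"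
    by (auto simp: abs_le_iff) (smt (verit))+
  then show "finite {k::int^'n. \<not> r \<le> norm (grid_point j k)}"
    by (rule finite_subset) (rule finite_int_box, simp)
qed

text \<open>
  The translates that are nonzero at \<open>y\<close> have their index in a box of fixed size centred at the
  componentwise floor of \<open>y\<close>, so their number is bounded independently of \<open>y\<close>.
\<close>

lemma tensor_finite_overlap:
  assumes "mother_scaling_function (\<phi> :: real \<Rightarrow> 'k::real_normed_field)"
  obtains N :: nat where
    "\<And>y::real^'n. finite {k. tensor \<phi> (y - int_vec k) \<noteq> 0}"
    "\<And>y::real^'n. card {k. tensor \<phi> (y - int_vec k) \<noteq> 0} \<le> N"
proof -
  obtain R :: nat where R: "\<And>x. \<phi> x \<noteq> 0 \<Longrightarrow> \<bar>x\<bar> \<le> real R"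
    using mother_scaling_function_support[OF assms] by blast
  define T where "T = {k::int^'n. \<forall>i. k $ i \<in> {- int R - 1..int R + 1}}"
  have T: "finite T"
    unfolding T_def by (rule finite_int_box) simp
  have sub: "{k. tensor \<phi> (y - int_vec k) \<noteq> 0} \<subseteq> (\<lambda>k. k + (\<chi> i. \<lfloor>y $ i\<rfloor>)) ` T" for y :: "real^'n"
  proof
    fix k assume "k \<in> {k. tensor \<phi> (y - int_vec k) \<noteq> 0}"
    then have "\<bar>(y - int_vec k) $ i\<bar> \<le> real R" for i
      using tensor_support[of \<phi> "real R", OF R] by blast
    then have "\<bar>y $ i - of_int (k $ i)\<bar> \<le> real R" for i
      by (simp add: int_vec_def)
    then have "real_of_int (- int R - 1) < of_int (k $ i - \<lfloor>y $ i\<rfloor>)"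
      "of_int (k $ i - \<lfloor>y $ i\<rfloor>) < real_of_int (int R + 1)" for i
      using floor_correct[of "y $ i"] unfolding abs_le_iff of_int_diff of_int_add of_int_minus of_int_of_nat_eq
      by (smt (verit) of_int_1)+
    then have "k $ i - \<lfloor>y $ i\<rfloor> \<in> {- int R - 1..int R + 1}" for i
      unfolding of_int_less_iff atLeastAtMost_iff by (meson less_imp_le)
    then have "k - (\<chi> i. \<lfloor>y $ i\<rfloor>) \<in> T"
      by (simp add: T_def)
    then show "k \<in> (\<lambda>k. k + (\<chi> i. \<lfloor>y $ i\<rfloor>)) ` T"
      by (rule rev_image_eqI) simp
  qed
  show thesis
  proof (rule that)
    fix y :: "real^'n"
    show "finite {k. tensor \<phi> (y - int_vec k) \<noteq> 0}"
      by (rule finite_subset[OF sub finite_imageI[OF T]])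
    show "card {k. tensor \<phi> (y - int_vec k) \<noteq> 0} \<le> card T"
      using card_mono[OF finite_imageI[OF T] sub] card_image_le[OF T] by (rule order_trans)
  qed
qed

lemma tensor_bounded_support:
  assumes "mother_scaling_function (\<phi> :: real \<Rightarrow> 'k::real_normed_field)"
  obtains r where "r > 0" "\<And>z::real^'n. tensor \<phi> z \<noteq> 0 \<Longrightarrow> norm z < r"
proof -
  obtain R :: nat where R: "\<And>x. \<phi> x \<noteq> 0 \<Longrightarrow> \<bar>x\<bar> \<le> real R"
    using mother_scaling_function_support[OF assms] by blast
  have "norm z < real CARD('n) * real R + 1" if "tensor \<phi> z \<noteq> 0" for z :: "real^'n"
  proof -
    have "norm z \<le> (\<Sum>i\<in>UNIV. \<bar>z $ i\<bar>)"
      by (rule norm_le_l1_cart)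
    also have "\<dots> \<le> (\<Sum>i\<in>(UNIV::'n set). real R)"
      using tensor_support[of \<phi> "real R", OF R that] by (intro sum_mono) auto
    finally show ?thesis by simp
  qed
  then show thesis
    by (intro that[of "real CARD('n) * real R + 1"] add_nonneg_pos) auto
qed

lemma tensor_int_vec:
  assumes "mother_scaling_function \<phi>"
  shows "tensor \<phi> (int_vec k) = (if k = 0 then 1 else 0)"
  using assms by (auto simp: tensor_def int_vec_def mother_scaling_function_def vec_eq_iff)

lemma tensor_dilate_tendsto_1:
  fixes \<phi> :: "real \<Rightarrow> 'k::real_normed_field" and z :: "real^'n"
  assumes "mother_scaling_function \<phi>"
  shows "(\<lambda>p. tensor \<phi> ((2 powi (- int p)) *\<^sub>R z)) \<longlonglongrightarrow> 1"
proof -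
  let ?\<Phi> = "tensor \<phi> :: real^'n \<Rightarrow> 'k"
  have "(\<lambda>p. ((1/2::real) ^ p) *\<^sub>R z) \<longlonglongrightarrow> 0 *\<^sub>R z"
    by (intro tendsto_intros LIMSEQ_power_zero) auto
  then have lim: "(\<lambda>p. ((1/2::real) ^ p) *\<^sub>R z) \<longlonglongrightarrow> 0"
    by simp
  have "isCont ?\<Phi> 0"
    using tensor_C0[OF assms, where 'n='n] by (auto simp: C0_def continuous_on_eq_continuous_at)
  then have "(\<lambda>p. ?\<Phi> (((1/2) ^ p) *\<^sub>R z)) \<longlonglongrightarrow> ?\<Phi> 0"
    using lim by (rule isCont_tendsto_compose)
  moreover have "?\<Phi> 0 = 1"
    using tensor_int_vec[OF assms, of "0::int^'n"] by simp
  ultimately show ?thesis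
    by (simp add: power_int_minus power_one_over inverse_eq_divide)
qed

text \<open>
  The number of nonzero terms at a point has a uniform bound, and \<open>\<Phi>\<close> is bounded.
  Only the coefficients of translates that do not vanish at \<open>y\<close> need to be small; the density argument
  depends on this locality.
\<close>

lemma norm_series_le:
  assumes "mother_scaling_function (\<phi> :: real \<Rightarrow> 'k::real_normed_field)"
  obtains C where "C > 0"
    "\<And>(y::real^'n) b s e. ((\<lambda>k. b k * tensor \<phi> (y - int_vec k)) has_sum s) UNIV \<Longrightarrow>
       (\<And>k. tensor \<phi> (y - int_vec k) \<noteq> 0 \<Longrightarrow> norm (b k) \<le> e) \<Longrightarrow> 0 \<le> e \<Longrightarrow> norm s \<le> C * e"
proof -
  obtain N :: nat where N: "\<And>y::real^'n. finite {k. tensor \<phi> (y - int_vec k) \<noteq> 0}"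
    "\<And>y::real^'n. card {k. tensor \<phi> (y - int_vec k) \<noteq> 0} \<le> N"
    using tensor_finite_overlap[OF assms] by blast
  have "bounded (range (tensor \<phi> :: real^'n \<Rightarrow> 'k))"
    using C0_subset_bcontfun[OF tensor_C0[OF assms]] by (auto simp: bcontfun_def)
  then obtain B where B: "B > 0" "\<And>x::real^'n. norm (tensor \<phi> x) \<le> B"
    by (auto simp: bounded_pos)
  show thesis
  proof (rule that)
    \<comment> \<open>With \<open>Suc N\<close> in place of \<open>N\<close> the constant is evidently positive.\<close>
    show "real (Suc N) * B > 0" using B by simp
    fix y :: "real^'n" and b s and e :: real
    assume s: "((\<lambda>k. b k * tensor \<phi> (y - int_vec k)) has_sum s) UNIV" and e: "0 \<le> e"
      and b: "\<And>k. tensor \<phi> (y - int_vec k) \<noteq> 0 \<Longrightarrow> norm (b k) \<le> e"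
    let ?A = "{k. tensor \<phi> (y - int_vec k) \<noteq> 0}"
    have "((\<lambda>k. b k * tensor \<phi> (y - int_vec k)) has_sum (\<Sum>k\<in>?A. b k * tensor \<phi> (y - int_vec k))) UNIV"
      by (rule has_sum_finite_neutralI[OF N(1)]) auto
    then have "norm s = norm (\<Sum>k\<in>?A. b k * tensor \<phi> (y - int_vec k))"
      using has_sum_unique[OF s] by simp
    also have "\<dots> \<le> (\<Sum>k\<in>?A. e * B)"
      using b B e by (intro sum_norm_le) (auto simp: norm_mult intro!: mult_mono)
    also have "\<dots> \<le> real (Suc N) * (e * B)"
      using N(2)[of y] B e by (simp only: sum_constant) (intro mult_right_mono, auto)
    finally show "norm s \<le> real (Suc N) * B * e"
      by (simp add: mult_ac)
  qed
qed

section \<open>Refinement\<close>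

text \<open>
  All sums are finite, so this is the distributive law. It transfers the one-dimensional refinement
  equation to the tensor product.
\<close>

lemma has_sum_prod_vec:
  fixes g :: "'n::finite \<Rightarrow> int \<Rightarrow> 'k::real_normed_field"
  assumes fin: "\<And>i. finite {m. g i m \<noteq> 0}" and sum: "\<And>i. (g i has_sum s i) UNIV"
  shows "((\<lambda>k::int^'n. \<Prod>i\<in>UNIV. g i (k $ i)) has_sum (\<Prod>i\<in>UNIV. s i)) UNIV"
proof (rule has_sum_finite_neutralI)
  define A where "A i = {m. g i m \<noteq> 0}" for i
  show "finite {k::int^'n. \<forall>i. k $ i \<in> A i}"
    using fin by (intro finite_int_box) (simp add: A_def)
  have "s i = (\<Sum>m\<in>A i. g i m)" for i
    by (rule has_sum_unique[OF sum], rule has_sum_finite_neutralI[of "A i"])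
      (use fin in \<open>auto simp: A_def\<close>)
  then have "(\<Prod>i\<in>UNIV. s i) = (\<Sum>p\<in>PiE UNIV A. \<Prod>i\<in>UNIV. g i (p i))"
    using fin by (simp only:) (rule prod_sum_PiE, auto simp: A_def)
  also have "\<dots> = (\<Sum>k\<in>{k::int^'n. \<forall>i. k $ i \<in> A i}. \<Prod>i\<in>UNIV. g i (k $ i))"
    by (rule sum.reindex_bij_witness[of _ vec_nth vec_lambda]) auto
  finally show "(\<Prod>i\<in>UNIV. s i) = (\<Sum>k\<in>{k::int^'n. \<forall>i. k $ i \<in> A i}. \<Prod>i\<in>UNIV. g i (k $ i))" .
  fix k :: "int^'n"
  assume "k \<in> UNIV - {k. \<forall>i. k $ i \<in> A i}"
  then show "(\<Prod>i\<in>UNIV. g i (k $ i)) = 0"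
    by (auto simp: A_def)
qed simp

lemma tensor_refinement:
  fixes \<phi> :: "real \<Rightarrow> 'k::real_normed_field" and y :: "real^'n"
  assumes "mother_scaling_function \<phi>"
  shows "((\<lambda>k. tensor \<phi> ((1/2) *\<^sub>R int_vec k) * tensor \<phi> (2 *\<^sub>R y - int_vec k)) has_sum tensor \<phi> y) UNIV"
proof -
  obtain R :: nat where R: "\<And>x. \<phi> x \<noteq> 0 \<Longrightarrow> \<bar>x\<bar> \<le> real R"
    using mother_scaling_function_support[OF assms] by blast
  define g where "g i m = \<phi> (of_int m / 2) * \<phi> (2 * y $ i - of_int m)" for i m
  have "\<bar>m\<bar> \<le> 2 * int R" if "g i m \<noteq> 0" for i m
  proof -
    have "\<bar>of_int m / 2\<bar> \<le> real R"
      using that by (intro R) (auto simp: g_def)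
    then show ?thesis by linarith
  qed
  then have "{m. g i m \<noteq> 0} \<subseteq> {- (2 * int R)..2 * int R}" for i
    by (auto simp: abs_le_iff) (smt (verit))+
  then have "finite {m. g i m \<noteq> 0}" for i
    by (rule finite_subset) simp
  moreover have "(g i has_sum \<phi> (y $ i)) UNIV" for i
    using assms unfolding g_def mother_scaling_function_def by blast
  ultimately have "((\<lambda>k::int^'n. \<Prod>i\<in>UNIV. g i (k $ i)) has_sum (\<Prod>i\<in>UNIV. \<phi> (y $ i))) UNIV"
    by (rule has_sum_prod_vec)
  then show ?thesis
    by (simp add: g_def tensor_def int_vec_def prod.distrib)
qed

section \<open>Functions reproduced by interpolation\<close>

text \<open>
  The function \<open>f\<close> is equal to its interpolant on the grid of mesh \<open>2^-j\<close>. Convergence is that at each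
  point, so that the condition is stable under pointwise limits.
\<close>

definition interpolated :: "(real^'n \<Rightarrow> 'k::real_normed_field) \<Rightarrow> int \<Rightarrow> (real^'n \<Rightarrow> 'k) \<Rightarrow> bool" where
  "interpolated \<Phi> j f \<longleftrightarrow>
     (\<forall>x. ((\<lambda>k. f (grid_point j k) * \<Phi> ((2 powi j) *\<^sub>R x - int_vec k)) has_sum f x) UNIV)"

lemma interpolatedD:
  "interpolated \<Phi> j f \<Longrightarrow>
     ((\<lambda>k. f (grid_point j k) * \<Phi> ((2 powi j) *\<^sub>R x - int_vec k)) has_sum f x) UNIV"
  by (simp add: interpolated_def)

lemma interpolated_cmult: "interpolated \<Phi> j f \<Longrightarrow> interpolated \<Phi> j (\<lambda>x. c * f x)"
  unfolding interpolated_def mult.assoc by (intro allI has_sum_cmult_right) auto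

lemma interpolated_sum:
  "(\<And>k. k \<in> F \<Longrightarrow> interpolated \<Phi> j (f k)) \<Longrightarrow> interpolated \<Phi> j (\<lambda>x. \<Sum>k\<in>F. f k x)"
proof (induction F rule: infinite_finite_induct)
  case (insert a F)
  then show ?case
    unfolding interpolated_def by (auto simp: distrib_right intro!: has_sum_add)
qed (auto simp: interpolated_def)

text \<open>
  At a given \<open>x\<close> the condition is an equation between \<open>f x\<close> and a finite linear combination of values
  of \<open>f\<close>, so pointwise limits preserve it.
\<close>

lemma interpolated_limit:
  assumes fin: "\<And>y. finite {k. \<Phi> (y - int_vec k) \<noteq> 0}" and G: "G \<noteq> bot"
    and lim: "\<And>x. ((\<lambda>F. s F x) \<longlongrightarrow> f x) G" and s: "\<And>F. interpolated \<Phi> j (s F)"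
  shows "interpolated \<Phi> j f"
  unfolding interpolated_def
proof
  fix x
  define A where "A = {k. \<Phi> ((2 powi j) *\<^sub>R x - int_vec k) \<noteq> 0}"
  have A: "((\<lambda>k. g (grid_point j k) * \<Phi> ((2 powi j) *\<^sub>R x - int_vec k)) has_sum
      (\<Sum>k\<in>A. g (grid_point j k) * \<Phi> ((2 powi j) *\<^sub>R x - int_vec k))) UNIV" for g
    by (rule has_sum_finite_neutralI[of A]) (use fin in \<open>auto simp: A_def\<close>)
  have "s F x = (\<Sum>k\<in>A. s F (grid_point j k) * \<Phi> ((2 powi j) *\<^sub>R x - int_vec k))" for F
    by (rule has_sum_unique[OF interpolatedD[OF s] A])
  then have "((\<lambda>F. \<Sum>k\<in>A. s F (grid_point j k) * \<Phi> ((2 powi j) *\<^sub>R x - int_vec k)) \<longlongrightarrow> f x) G"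
    using lim[of x] by simp
  moreover have "((\<lambda>F. \<Sum>k\<in>A. s F (grid_point j k) * \<Phi> ((2 powi j) *\<^sub>R x - int_vec k)) \<longlongrightarrow>
      (\<Sum>k\<in>A. f (grid_point j k) * \<Phi> ((2 powi j) *\<^sub>R x - int_vec k))) G"
    by (intro tendsto_intros lim)
  ultimately have "f x = (\<Sum>k\<in>A. f (grid_point j k) * \<Phi> ((2 powi j) *\<^sub>R x - int_vec k))"
    by (rule tendsto_unique[OF G])
  then show "((\<lambda>k. f (grid_point j k) * \<Phi> ((2 powi j) *\<^sub>R x - int_vec k)) has_sum f x) UNIV"
    using A[of f] by simp
qed

text \<open>
  The levels \<open>i\<close> and \<open>j\<close> are independent: with \<open>i = j\<close> the lemma characterises the spaces, with
  \<open>i = j + 1\<close> it shows that they are nested. In both cases it reduces the claim to single translates.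
\<close>

lemma interpolated_series:
  assumes fin: "\<And>y. finite {k. \<Phi> (y - int_vec k) \<noteq> 0}"
    and translates: "\<And>l. interpolated \<Phi> i (\<lambda>x. \<Phi> ((2 powi j) *\<^sub>R x - int_vec l))"
    and f: "\<And>x. ((\<lambda>k. a k * \<Phi> ((2 powi j) *\<^sub>R x - int_vec k)) has_sum f x) UNIV"
  shows "interpolated \<Phi> i f"
proof (rule interpolated_limit[OF fin, where G = "finite_subsets_at_top UNIV"])
  show "((\<lambda>F. \<Sum>k\<in>F. a k * \<Phi> ((2 powi j) *\<^sub>R x - int_vec k)) \<longlongrightarrow> f x) (finite_subsets_at_top UNIV)" for x
    using f[of x] by (simp add: has_sum_def)
qed (simp, intro interpolated_sum interpolated_cmult translates)

lemma interpolated_translate: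
  assumes "mother_scaling_function \<phi>"
  shows "interpolated (tensor \<phi>) j (\<lambda>x::real^'n. tensor \<phi> ((2 powi j) *\<^sub>R x - int_vec l))"
  unfolding interpolated_def
proof
  fix x :: "real^'n"
  show "((\<lambda>k. tensor \<phi> ((2 powi j) *\<^sub>R grid_point j k - int_vec l) *
      tensor \<phi> ((2 powi j) *\<^sub>R x - int_vec k)) has_sum tensor \<phi> ((2 powi j) *\<^sub>R x - int_vec l)) UNIV"
    by (rule has_sum_finite_neutralI[of "{l}"])
      (use tensor_int_vec[OF assms, of "0::int^'n"] in \<open>auto simp: tensor_int_vec[OF assms] simp flip: int_vec_diff\<close>)
qed

text \<open>
  This is the refinement equation at the point \<open>y = 2^j x - l\<close>. The summation index is shifted by
  \<open>2 l\<close> because \<open>2 y - k = 2^(j+1) x - (k + 2 l)\<close>; the shift is written \<open>l + l\<close> so that additivity of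
  \<^const>\<open>int_vec\<close> applies.
\<close>

lemma interpolated_translate_finer:
  assumes "mother_scaling_function \<phi>"
  shows "interpolated (tensor \<phi>) (j + 1) (\<lambda>x::real^'n. tensor \<phi> ((2 powi j) *\<^sub>R x - int_vec l))"
  unfolding interpolated_def
proof
  fix x :: "real^'n"
  define y where "y = (2 powi j) *\<^sub>R x - int_vec l"
  have "((\<lambda>k. tensor \<phi> ((1/2) *\<^sub>R int_vec k) * tensor \<phi> (2 *\<^sub>R y - int_vec k)) has_sum tensor \<phi> y) UNIV"
    by (rule tensor_refinement[OF assms])
  also have "?this \<longleftrightarrow> ((\<lambda>k. tensor \<phi> ((2 powi j) *\<^sub>R grid_point (j + 1) k - int_vec l) *
      tensor \<phi> ((2 powi (j + 1)) *\<^sub>R x - int_vec k)) has_sum tensor \<phi> y) UNIV"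
  proof (rule has_sum_reindex_bij_witness[of _ "\<lambda>k. k - (l + l)" "\<lambda>k. k + (l + l)"])
    fix k :: "int^'n"
    have "(2 powi j) *\<^sub>R grid_point (j + 1) k' = (1/2) *\<^sub>R int_vec k'" for k' :: "int^'n"
      by (simp add: grid_point_def power_int_add power_int_diff power_int_minus)
    then have 1: "(2 powi j) *\<^sub>R grid_point (j + 1) (k + (l + l)) - int_vec l = (1/2) *\<^sub>R int_vec k"
      by (simp only: int_vec_add scaleR_add_right) (simp flip: scaleR_add_left)
    have 2: "(2 powi (j + 1)) *\<^sub>R x - int_vec (k + (l + l)) = 2 *\<^sub>R y - int_vec k"
      unfolding int_vec_add y_def by (simp add: power_int_add scaleR_diff_right scaleR_2 mult.commute flip: scaleR_scaleR)
    show "tensor \<phi> ((2 powi j) *\<^sub>R grid_point (j + 1) (k + (l + l)) - int_vec l) *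
        tensor \<phi> ((2 powi (j + 1)) *\<^sub>R x - int_vec (k + (l + l))) =
        tensor \<phi> ((1/2) *\<^sub>R int_vec k) * tensor \<phi> (2 *\<^sub>R y - int_vec k)"
      unfolding 1 2 ..
  qed auto
  finally show "((\<lambda>k. tensor \<phi> ((2 powi j) *\<^sub>R grid_point (j + 1) k - int_vec l) *
      tensor \<phi> ((2 powi (j + 1)) *\<^sub>R x - int_vec k)) has_sum tensor \<phi> ((2 powi j) *\<^sub>R x - int_vec l)) UNIV"
    by (simp add: y_def)
qed

lemma interpolated_nested:
  fixes f :: "real^'n \<Rightarrow> 'k::real_normed_field"
  assumes "mother_scaling_function \<phi>" and "interpolated (tensor \<phi>) j f"
  shows "interpolated (tensor \<phi>) (j + 1) f"
proof (rule interpolated_series[OF _ interpolated_translate_finer[OF assms(1)] interpolatedD[OF assms(2)]])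
  show "finite {k. tensor \<phi> (y - int_vec k) \<noteq> 0}" for y :: "real^'n"
    using tensor_finite_overlap[OF assms(1), where 'n='n] by blast
qed

text \<open>
  At level \<open>0\<close> this is the interpolation property of \<open>\<Phi>\<close> itself, and nestedness carries it to every finer
  level.
\<close>

lemma tensor_interpolated:
  assumes "mother_scaling_function \<phi>"
  shows "interpolated (tensor \<phi> :: real^'n \<Rightarrow> 'k::real_normed_field) (int j) (tensor \<phi>)"
proof (induction j)
  case 0
  show ?case
    using interpolated_translate[OF assms, of 0 0] by simp
next
  case (Suc j)
  then show ?case
    using interpolated_nested[OF assms, of "int j"] by (simp add: add.commute)
qed

text \<open>
  Reproduction of \<open>\<Phi>\<close> on the grid of mesh \<open>2^-p\<close>, read at \<open>2^-p y\<close>, expresses \<open>\<Phi> (2^-p y)\<close> through the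
  numbers \<open>\<Phi> (y - k)\<close>, which do not depend on \<open>p\<close>, with weights \<open>\<Phi> (2^-p k)\<close>. The left-hand side and the
  weights all tend to \<open>1\<close>, and only finitely many terms are involved.
\<close>

lemma partition_of_unity:
  fixes \<phi> :: "real \<Rightarrow> 'k::real_normed_field" and y :: "real^'n"
  assumes "mother_scaling_function \<phi>"
  shows "((\<lambda>k. tensor \<phi> (y - int_vec k)) has_sum 1) UNIV"
proof -
  let ?\<Phi> = "tensor \<phi> :: real^'n \<Rightarrow> 'k"
  define A where "A = {k. ?\<Phi> (y - int_vec k) \<noteq> 0}"
  have A: "finite A"
    unfolding A_def using tensor_finite_overlap[OF assms, where 'n='n] by blast
  have "?\<Phi> ((2 powi (- int p)) *\<^sub>R y) =
      (\<Sum>k\<in>A. ?\<Phi> ((2 powi (- int p)) *\<^sub>R int_vec k) * ?\<Phi> (y - int_vec k))" for p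
  proof (rule has_sum_unique)
    show "((\<lambda>k. ?\<Phi> ((2 powi (- int p)) *\<^sub>R int_vec k) * ?\<Phi> (y - int_vec k)) has_sum
        ?\<Phi> ((2 powi (- int p)) *\<^sub>R y)) UNIV"
      using interpolatedD[OF tensor_interpolated[OF assms, of p], of "(2 powi (- int p)) *\<^sub>R y"]
      by (simp add: grid_point_def power_int_minus)
  qed (rule has_sum_finite_neutralI[OF A], auto simp: A_def)
  then have "(\<lambda>p. \<Sum>k\<in>A. ?\<Phi> ((2 powi (- int p)) *\<^sub>R int_vec k) * ?\<Phi> (y - int_vec k)) \<longlonglongrightarrow> 1"
    using tensor_dilate_tendsto_1[OF assms, of y] by simp
  moreover have "(\<lambda>p. \<Sum>k\<in>A. ?\<Phi> ((2 powi (- int p)) *\<^sub>R int_vec k) * ?\<Phi> (y - int_vec k))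
      \<longlonglongrightarrow> (\<Sum>k\<in>A. 1 * ?\<Phi> (y - int_vec k))"
    by (intro tendsto_intros tensor_dilate_tendsto_1 assms)
  ultimately have "1 = (\<Sum>k\<in>A. ?\<Phi> (y - int_vec k))"
    using LIMSEQ_unique by fastforce
  then show ?thesis
    by (intro has_sum_finite_neutralI[OF A]) (auto simp: A_def)
qed

section \<open>Characterisation of the spaces\<close>

lemma c0_samples:
  assumes "f \<in> (C0 :: (real^'n \<Rightarrow> 'k::real_normed_field) set)"
  shows "(\<lambda>k. f (grid_point j k)) \<in> c0"
proof -
  have "(f \<longlongrightarrow> 0) at_infinity"
    using assms by (simp add: C0_def)
  then show ?thesis
    unfolding c0_def mem_Collect_eq by (rule filterlim_compose[OF _ filterlim_grid_point])
qed

lemma series_in_V0: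
  fixes a :: "int^'n \<Rightarrow> 'k::real_normed_field"
  assumes "mother_scaling_function \<phi>" and "a \<in> c0"
  obtains f where "f \<in> V0 (tensor \<phi>) j"
    "\<And>x. ((\<lambda>k. a k * tensor \<phi> ((2 powi j) *\<^sub>R x - int_vec k)) has_sum f x) UNIV"
proof -
  obtain f where f: "f \<in> V0 (tensor \<phi>) j" "uniform_limit UNIV
       (\<lambda>F x. \<Sum>k\<in>F. a k * tensor \<phi> ((2 powi j) *\<^sub>R x - int_vec k)) f (finite_subsets_at_top UNIV)"
    using V0_series_converges[OF assms, of j] by blast
  show thesis
    by (rule that[OF f(1)]) (simp add: has_sum_def tendsto_uniform_limitI[OF f(2)])
qed

text \<open>
  A function in the space is a limit of combinations of translates of level \<open>j\<close>, all of which are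
  reproduced at that level. Conversely, the samples of a function in \<^const>\<open>C0\<close> are admissible
  coefficients; the series with these coefficients converges uniformly, and its sum is the function by
  reproduction.
\<close>

lemma V0_eq_interpolated:
  assumes "mother_scaling_function \<phi>"
  shows "V0 (tensor \<phi>) j = {f \<in> C0. interpolated (tensor \<phi> :: real^'n \<Rightarrow> 'k::real_normed_field) j f}"
proof (intro equalityI subsetI)
  fix f assume f: "f \<in> V0 (tensor \<phi> :: real^'n \<Rightarrow> 'k) j"
  then obtain a where a: "uniform_limit UNIV
       (\<lambda>F x. \<Sum>k\<in>F. a k * tensor \<phi> ((2 powi j) *\<^sub>R x - int_vec k)) f (finite_subsets_at_top UNIV)"
    by (auto simp: V0_def)
  have "interpolated (tensor \<phi>) j f"
  proof (rule interpolated_series[OF _ interpolated_translate[OF assms]])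
    show "finite {k. tensor \<phi> (y - int_vec k) \<noteq> 0}" for y :: "real^'n"
      using tensor_finite_overlap[OF assms, where 'n='n] by blast
    show "((\<lambda>k. a k * tensor \<phi> ((2 powi j) *\<^sub>R x - int_vec k)) has_sum f x) UNIV" for x
      using tendsto_uniform_limitI[OF a, of x] by (simp add: has_sum_def)
  qed
  then show "f \<in> {f \<in> C0. interpolated (tensor \<phi>) j f}"
    using f V0_subset_C0[OF assms] by auto
next
  fix f assume "f \<in> {f \<in> C0. interpolated (tensor \<phi> :: real^'n \<Rightarrow> 'k) j f}"
  then have f: "f \<in> C0" "interpolated (tensor \<phi>) j f"
    by auto
  obtain g where g: "g \<in> V0 (tensor \<phi>) j"
    "\<And>x. ((\<lambda>k. f (grid_point j k) * tensor \<phi> ((2 powi j) *\<^sub>R x - int_vec k)) has_sum g x) UNIV"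
    using series_in_V0[OF assms c0_samples[OF f(1)]] by blast
  have "f = g"
    using has_sum_unique[OF interpolatedD[OF f(2)] g(2)] by blast
  then show "f \<in> V0 (tensor \<phi>) j"
    using g(1) by simp
qed

section \<open>The multiresolution conditions\<close>

lemma C0_uniformly_continuous:
  fixes f :: "'a::euclidean_space \<Rightarrow> 'k::real_normed_vector"
  assumes "f \<in> C0"
  shows "uniformly_continuous_on UNIV f"
  unfolding uniformly_continuous_on_def
proof (intro allI impI)
  fix e :: real assume e: "e > 0"
  have c: "continuous_on UNIV f" and l: "(f \<longlongrightarrow> 0) at_infinity"
    using assms by (auto simp: C0_def)
  obtain b where b: "\<And>x. b \<le> norm x \<Longrightarrow> norm (f x) < e / 2"
    using tendstoD[OF l, of "e / 2"] e by (auto simp: eventually_at_infinity)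
  have "uniformly_continuous_on (cball 0 (b + 1)) f"
    by (rule compact_uniformly_continuous[OF continuous_on_subset[OF c]]) auto
  then obtain d where d: "d > 0"
    "\<And>x y. x \<in> cball 0 (b + 1) \<Longrightarrow> y \<in> cball 0 (b + 1) \<Longrightarrow> dist y x < d \<Longrightarrow> dist (f y) (f x) < e"
    using e unfolding uniformly_continuous_on_def by metis
  \<comment> \<open>If the distance is below 1, either both points lie in the larger ball or both lie outside the
    smaller one.\<close>
  have "dist (f y) (f x) < e" if xy: "dist y x < min d 1" for x y
  proof (cases "b \<le> norm x \<and> b \<le> norm y")
    case True
    then have "norm (f x) < e / 2" "norm (f y) < e / 2"
      using b by auto
    then show ?thesis
      using norm_triangle_ineq4[of "f y" "f x"] by (simp add: dist_norm)
  next
    case False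
    then have "norm x \<le> b + 1" "norm y \<le> b + 1"
      using xy norm_triangle_ineq3[of y x] by (auto simp: dist_norm)
    then show ?thesis
      using d xy by simp
  qed
  then show "\<exists>d>0. \<forall>x\<in>UNIV. \<forall>x'\<in>UNIV. dist x' x < d \<longrightarrow> dist (f x') (f x) < e"
    using d(1) by (intro exI[of _ "min d 1"]) auto
qed

text \<open>
  Uniform limits preserve decay at infinity, which gives one inclusion. For the other one, \<open>g\<close> is
  approximated by its interpolant \<open>h\<close> at a fine level. The partition of unity allows \<open>g x\<close> to be written
  as a series as well, so that the error has the coefficients \<open>g (2^-j k) - g x\<close>. Where they
  matter, the grid point is closer than \<open>2^-j r\<close> to \<open>x\<close>, with \<open>r\<close> a radius of the support.
\<close>

lemma V0_dense:
  fixes \<phi> :: "real \<Rightarrow> 'k::real_normed_field"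
  assumes "mother_scaling_function \<phi>"
  shows "closure {g :: (real^'n) \<Rightarrow>\<^sub>C 'k. apply_bcontfun g \<in> (\<Union>j. V0 (tensor \<phi>) j)} =
    {g. apply_bcontfun g \<in> C0}"
proof (intro equalityI subsetI)
  fix g :: "(real^'n) \<Rightarrow>\<^sub>C 'k"
  assume g: "g \<in> closure {g. apply_bcontfun g \<in> (\<Union>j. V0 (tensor \<phi>) j)}"
  have "(apply_bcontfun g \<longlongrightarrow> 0) at_infinity"
  proof (rule tendstoI)
    fix e :: real assume e: "e > 0"
    obtain h j where h: "apply_bcontfun h \<in> V0 (tensor \<phi>) j" "dist h g < e / 2"
      using g e unfolding closure_approachable by (auto dest!: spec[of _ "e/2"])
    then have "(apply_bcontfun h \<longlongrightarrow> 0) at_infinity"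
      using V0_subset_C0[OF assms] by (auto simp: C0_def)
    then have "\<forall>\<^sub>F x in at_infinity. dist (apply_bcontfun h x) 0 < e / 2"
      using e by (intro tendstoD) auto
    then show "\<forall>\<^sub>F x in at_infinity. dist (apply_bcontfun g x) 0 < e"
    proof eventually_elim
      case (elim x)
      then show ?case
        using dist_fun_lt_imp_dist_val_lt[OF h(2), of x]
          dist_triangle[of "apply_bcontfun g x" 0 "apply_bcontfun h x"] by (simp add: dist_commute)
    qed
  qed
  then show "g \<in> {g. apply_bcontfun g \<in> C0}"
    by (simp add: C0_def)
next
  fix g :: "(real^'n) \<Rightarrow>\<^sub>C 'k"
  assume "g \<in> {g. apply_bcontfun g \<in> C0}"
  then have g: "apply_bcontfun g \<in> C0" by simp
  obtain C where C: "C > 0"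
    "\<And>(y::real^'n) b s e. ((\<lambda>k. b k * tensor \<phi> (y - int_vec k)) has_sum s) UNIV \<Longrightarrow>
       (\<And>k. tensor \<phi> (y - int_vec k) \<noteq> 0 \<Longrightarrow> norm (b k) \<le> e) \<Longrightarrow> 0 \<le> e \<Longrightarrow> norm s \<le> C * e"
    using norm_series_le[OF assms] by blast
  obtain r where r: "r > 0" "\<And>z::real^'n. tensor \<phi> z \<noteq> 0 \<Longrightarrow> norm z < r"
    using tensor_bounded_support[OF assms] by blast
  show "g \<in> closure {g. apply_bcontfun g \<in> (\<Union>j. V0 (tensor \<phi>) j)}"
    unfolding closure_approachable
  proof (intro allI impI)
    fix e :: real assume e: "e > 0"
    define e' where "e' = e / (2 * C)"
    have e': "e' > 0" "C * e' < e"
      using e C(1) by (simp_all add: e'_def)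
    obtain d where d: "d > 0" "\<And>x y. dist y x < d \<Longrightarrow> dist (apply_bcontfun g y) (apply_bcontfun g x) < e'"
      using C0_uniformly_continuous[OF g] e'(1) unfolding uniformly_continuous_on_def by (metis UNIV_I)
    obtain p :: nat where p: "(1/2) ^ p < d / r"
      using real_arch_pow_inv[of "d / r" "1/2"] d(1) r(1) by auto
    define j where "j = int p"
    have j: "2 powi (- j) * r < d"
      using p r(1) by (simp add: j_def power_int_minus power_int_of_nat power_one_over field_simps)
    obtain h where h: "h \<in> V0 (tensor \<phi>) j"
      "\<And>x. ((\<lambda>k. apply_bcontfun g (grid_point j k) * tensor \<phi> ((2 powi j) *\<^sub>R x - int_vec k)) has_sum h x) UNIV"
      using series_in_V0[OF assms c0_samples[OF g]] by blast
    have "norm (h x - apply_bcontfun g x) \<le> C * e'" for x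
    proof (rule C(2))
      have "((\<lambda>k. apply_bcontfun g x * tensor \<phi> ((2 powi j) *\<^sub>R x - int_vec k)) has_sum apply_bcontfun g x * 1) UNIV"
        by (intro has_sum_cmult_right partition_of_unity assms)
      from has_sum_add[OF h(2)[of x] has_sum_uminusI[OF this]]
      show "((\<lambda>k. (apply_bcontfun g (grid_point j k) - apply_bcontfun g x) *
          tensor \<phi> ((2 powi j) *\<^sub>R x - int_vec k)) has_sum h x - apply_bcontfun g x) UNIV"
        by (simp add: algebra_simps)
      fix k assume "tensor \<phi> ((2 powi j) *\<^sub>R x - int_vec k) \<noteq> 0"
      then have "norm ((2 powi j) *\<^sub>R x - int_vec k) < r"
        by (rule r(2))
      then have "2 powi (- j) * norm ((2 powi j) *\<^sub>R x - int_vec k) < d"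
        using j by (smt (verit) mult_less_cancel_left_pos zero_less_power_int)
      also have "2 powi (- j) * norm ((2 powi j) *\<^sub>R x - int_vec k) = dist x (grid_point j k)"
      proof -
        have "x - grid_point j k = (2 powi (- j)) *\<^sub>R ((2 powi j) *\<^sub>R x - int_vec k)"
          by (simp add: grid_point_def power_int_minus scaleR_diff_right)
        then show ?thesis
          by (simp add: dist_norm)
      qed
      finally show "norm (apply_bcontfun g (grid_point j k) - apply_bcontfun g x) \<le> e'"
        using d(2)[of "grid_point j k" x] by (simp add: dist_commute[of x] less_imp_le flip: dist_norm)
    qed (use e' in simp)
    moreover have "h \<in> bcontfun"
      using h(1) V0_subset_C0[OF assms] C0_subset_bcontfun by blast
    ultimately have "dist (Bcontfun h) g \<le> C * e'"
      by (intro dist_bound) (simp add: Bcontfun_inverse dist_norm)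
    then have "dist (Bcontfun h) g < e"
      using e'(2) by simp
    then show "\<exists>y\<in>{g. apply_bcontfun g \<in> (\<Union>j. V0 (tensor \<phi>) j)}. dist y g < e"
      using h(1) \<open>h \<in> bcontfun\<close> by (intro bexI[of _ "Bcontfun h"]) (auto simp: Bcontfun_inverse)
  qed
qed

text \<open>
  On a coarse grid only the term \<open>k = 0\<close> of the interpolation formula survives, because all other grid
  points are far from the origin. Its weight \<open>\<Phi> (2^j x)\<close> tends to \<open>1\<close>, so \<open>f x = f 0\<close>.
\<close>

lemma V0_Inter:
  fixes \<phi> :: "real \<Rightarrow> 'k::real_normed_field"
  assumes "mother_scaling_function \<phi>"
  shows "(\<Inter>j. V0 (tensor \<phi> :: real^'n \<Rightarrow> 'k) j) = {\<lambda>x. 0}"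
proof (intro equalityI subsetI)
  fix f assume "f \<in> (\<Inter>j. V0 (tensor \<phi> :: real^'n \<Rightarrow> 'k) j)"
  then have f: "f \<in> C0" "\<And>j. interpolated (tensor \<phi>) j f"
    by (auto simp: V0_eq_interpolated[OF assms])
  then have l: "(f \<longlongrightarrow> 0) at_infinity"
    by (simp add: C0_def)
  obtain C where C: "C > 0"
    "\<And>(y::real^'n) b s e. ((\<lambda>k. b k * tensor \<phi> (y - int_vec k)) has_sum s) UNIV \<Longrightarrow>
       (\<And>k. tensor \<phi> (y - int_vec k) \<noteq> 0 \<Longrightarrow> norm (b k) \<le> e) \<Longrightarrow> 0 \<le> e \<Longrightarrow> norm s \<le> C * e"
    using norm_series_le[OF assms] by blast
  have const: "f x = f 0" for x
  proof -
    define u where "u p = f x - f 0 * tensor \<phi> ((2 powi (- int p)) *\<^sub>R x)" for p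
    have "u \<longlonglongrightarrow> 0"
    proof (rule LIMSEQ_I)
      fix e :: real assume e: "e > 0"
      define e' where "e' = e / (2 * C)"
      have e': "e' > 0" "C * e' < e"
        using e C(1) by (simp_all add: e'_def)
      obtain b where b: "\<And>x. b \<le> norm x \<Longrightarrow> norm (f x) < e'"
        using tendstoD[OF l e'(1)] by (auto simp: eventually_at_infinity)
      obtain p0 :: nat where p0: "b < 2 ^ p0"
        using real_arch_pow[of 2 b] by auto
      have "norm (u p) < e" if p: "p \<ge> p0" for p
      proof -
        define j where "j = - int p"
        have bp: "b \<le> 2 powi (- j)"
          using order_trans[OF less_imp_le[OF p0] power_increasing[OF p]] by (simp add: j_def)
        let ?s = "\<lambda>k. f (grid_point j k) * tensor \<phi> ((2 powi j) *\<^sub>R x - int_vec k)"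
        have "(?s has_sum f x) UNIV"
          by (rule interpolatedD[OF f(2)])
        \<comment> \<open>Without its term \<open>k = 0\<close>, the series for \<open>f x\<close> has only small coefficients.\<close>
        moreover have "((\<lambda>k. if k = 0 then - ?s k else 0) has_sum - ?s 0) UNIV"
          by (rule has_sum_finite_neutralI[of "{0}"]) auto
        ultimately have "((\<lambda>k. ?s k + (if k = 0 then - ?s k else 0)) has_sum f x + - ?s 0) UNIV"
          by (rule has_sum_add)
        also have "(\<lambda>k. ?s k + (if k = 0 then - ?s k else 0)) =
            (\<lambda>k. (if k = 0 then 0 else f (grid_point j k)) * tensor \<phi> ((2 powi j) *\<^sub>R x - int_vec k))"
          by auto
        also have "f x + - ?s 0 = u p"
          by (simp add: u_def j_def)
        finally have "norm (u p) \<le> C * e'"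
        proof (rule C(2))
          fix k :: "int^'n"
          show "norm (if k = 0 then 0 else f (grid_point j k)) \<le> e'"
            using b[of "grid_point j k"] norm_grid_point_ge[of k j] bp e'(1) by auto
        qed (use e' in simp)
        then show ?thesis using e'(2) by simp
      qed
      then show "\<exists>no. \<forall>n\<ge>no. norm (u n - 0) < e"
        by auto
    qed
    moreover have "u \<longlonglongrightarrow> f x - f 0 * 1"
      unfolding u_def by (intro tendsto_intros tensor_dilate_tendsto_1 assms)
    ultimately show ?thesis
      using LIMSEQ_unique by fastforce
  qed
  have "f = (\<lambda>x. f 0)"
    using const by (rule ext)
  then have "((\<lambda>x::real^'n. f 0) \<longlongrightarrow> 0) at_infinity"
    using l by simp
  then have "f 0 = 0"
    by (subst (asm) tendsto_const_iff) (simp_all add: trivial_limit_at_infinity)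
  then show "f \<in> {\<lambda>x. 0}"
    using const by auto
next
  fix f :: "real^'n \<Rightarrow> 'k" assume "f \<in> {\<lambda>x. 0}"
  then show "f \<in> (\<Inter>j. V0 (tensor \<phi> :: real^'n \<Rightarrow> 'k) j)"
    by (auto simp: V0_eq_interpolated[OF assms] C0_def interpolated_def)
qed

lemma V0_dilate:
  fixes f :: "real^'n \<Rightarrow> 'k::real_normed_field"
  shows "f \<in> V0 \<Phi> j \<longleftrightarrow> (\<lambda>x. f (2 *\<^sub>R x)) \<in> V0 \<Phi> (j + 1)"
proof -
  have halve: "(\<forall>x::real^'n. P x) \<longleftrightarrow> (\<forall>x. P (2 *\<^sub>R x))" for P :: "real^'n \<Rightarrow> bool"
  proof
    assume "\<forall>x. P (2 *\<^sub>R x)"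
    then have "P (2 *\<^sub>R ((1/2) *\<^sub>R x))" for x by blast
    then show "\<forall>x. P x" by simp
  qed simp
  have limit: "uniform_limit UNIV s f G \<longleftrightarrow> uniform_limit UNIV (\<lambda>F x. s F (2 *\<^sub>R x)) (\<lambda>x. f (2 *\<^sub>R x)) G"
    for s :: "(int^'n) set \<Rightarrow> real^'n \<Rightarrow> 'k" and G
    unfolding uniform_limit_iff ball_UNIV
    using halve[of "\<lambda>x. dist (s F x) (f x) < e" for F e] by simp
  have scale: "(2 powi (j + 1)) *\<^sub>R x = (2 powi j) *\<^sub>R (2 *\<^sub>R x)" for x :: "real^'n"
    by (simp add: power_int_add)
  show ?thesis
    unfolding V0_def mem_Collect_eq scale by (rule bex_cong[OF refl limit])
qed

text \<open>
  A translation by a grid point permutes the grid, so it preserves reproduction on it.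
\<close>

lemma V0_translate:
  fixes \<phi> :: "real \<Rightarrow> 'k::real_normed_field" and f :: "real^'n \<Rightarrow> 'k"
  assumes "mother_scaling_function \<phi>" and "f \<in> V0 (tensor \<phi>) j"
  shows "(\<lambda>x. f (x - grid_point j m)) \<in> V0 (tensor \<phi>) j"
proof -
  have f: "f \<in> C0" "interpolated (tensor \<phi>) j f"
    using assms by (auto simp: V0_eq_interpolated)
  have "filterlim (\<lambda>x. x - grid_point j m) at_infinity at_infinity"
    unfolding diff_conv_add_uminus
    by (subst add.commute)
      (rule tendsto_add_filterlim_at_infinity, rule tendsto_const, rule filterlim_ident)
  then have "(\<lambda>x. f (x - grid_point j m)) \<in> C0"
    using f(1) unfolding C0_def
    by (auto intro: filterlim_compose intro!: continuous_intros continuous_on_compose2[of UNIV f])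
  moreover have "interpolated (tensor \<phi>) j (\<lambda>x. f (x - grid_point j m))"
    unfolding interpolated_def
  proof
    fix x
    have "((\<lambda>k. f (grid_point j k) * tensor \<phi> ((2 powi j) *\<^sub>R (x - grid_point j m) - int_vec k))
        has_sum f (x - grid_point j m)) UNIV"
      by (rule interpolatedD[OF f(2)])
    also have "?this \<longleftrightarrow> ((\<lambda>k. f (grid_point j k - grid_point j m) *
        tensor \<phi> ((2 powi j) *\<^sub>R x - int_vec k)) has_sum f (x - grid_point j m)) UNIV"
      by (rule has_sum_reindex_bij_witness[of _ "\<lambda>k. k - m" "\<lambda>k. k + m"])
        (auto simp: int_vec_add grid_point_def scaleR_add_right scaleR_diff_right power_int_minus algebra_simps)
    finally show "((\<lambda>k. f (grid_point j k - grid_point j m) *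
        tensor \<phi> ((2 powi j) *\<^sub>R x - int_vec k)) has_sum f (x - grid_point j m)) UNIV" .
  qed
  ultimately show ?thesis
    by (simp add: V0_eq_interpolated[OF assms(1)])
qed

lemma V0_translate_iff:
  fixes \<phi> :: "real \<Rightarrow> 'k::real_normed_field" and f :: "real^'n \<Rightarrow> 'k"
  assumes "mother_scaling_function \<phi>"
  shows "f \<in> V0 (tensor \<phi>) j \<longleftrightarrow> (\<lambda>x. f (x - grid_point j m)) \<in> V0 (tensor \<phi>) j"
proof
  assume "(\<lambda>x. f (x - grid_point j m)) \<in> V0 (tensor \<phi>) j"
  from V0_translate[OF assms this, of "- m"] show "f \<in> V0 (tensor \<phi>) j"
    by (simp add: grid_point_def int_vec_uminus)
qed (rule V0_translate[OF assms])

lemma MRA2_tensor: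
  fixes \<phi> :: "real \<Rightarrow> 'k::real_normed_field"
  assumes "mother_scaling_function \<phi>"
  shows "MRA2 (tensor \<phi> :: real^'n \<Rightarrow> 'k) (V0 (tensor \<phi>))"
  unfolding MRA2_def
proof (intro conjI allI)
  show "V0 (tensor \<phi> :: real^'n \<Rightarrow> 'k) j \<subseteq> V0 (tensor \<phi>) (j + 1)" for j
    using interpolated_nested[OF assms] by (auto simp: V0_eq_interpolated[OF assms])
  show "f \<in> V0 (tensor \<phi>) j \<longleftrightarrow> (\<lambda>x. f (x - (2 powi (- j)) *\<^sub>R int_vec k)) \<in> V0 (tensor \<phi>) j"
    for j k and f :: "real^'n \<Rightarrow> 'k"
    using V0_translate_iff[OF assms] by (simp add: grid_point_def)
qed (rule V0_dense[OF assms] V0_Inter[OF assms] V0_dilate tensor_int_vec[OF assms])+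

theorem lemma7p3:
  shows "(\<forall>\<phi> :: real \<Rightarrow> real. mother_scaling_function \<phi> \<longrightarrow>
            MRA2 (tensor \<phi> :: real^'n \<Rightarrow> real) (V0 (tensor \<phi>))) \<and>
         (\<forall>\<phi> :: real \<Rightarrow> complex. mother_scaling_function \<phi> \<longrightarrow>
            MRA2 (tensor \<phi> :: real^'n \<Rightarrow> complex) (V0 (tensor \<phi>)))"
  by (simp add: MRA2_tensor)

end
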